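(* Let $R$ be a ring satisfying $[x^2-x,y]=0$ for all $x,y\in R$. Then $R$ is commutative.
   Context: Rings are associative but are not assumed to have a unity. For $x,y$ in a ring, $[x,y]=xy-yx$. *)

theory Defs
  imports Main
begin

text \<open>
  The type class \<^class>\<open>ring\<close> is the class of associative rings that need not have a unity,
  so the power notation is not available in it and squares are written as products.
\<close>

definition commutator :: "'a::ring \<Rightarrow> 'a \<Rightarrow> 'a"
  where "commutator x y = x * y - y * x"

end

theory Submission
  imports Defs
begin

text \<open>Central elements form an additive subgroup containing every \<open>a * a - a\<close>, so
  it is enough that squares are central. This follows from the centrality of
  \<open>x * y + y * x\<close>, the polarization of \<open>a * a - a\<close>.\<close>

theorem theorem3p5:
  assumes "\<And>x y :: 'a::ring. commutator (x * x - x) y = 0"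
  shows "\<forall>x y :: 'a. x * y = y * x"
proof (intro allI)
  fix x y :: 'a
  have comm: "(a * a - a) * b = b * (a * a - a)" for a b :: 'a
    using assms[of a b] by (simp add: commutator_def)
  \<comment> \<open>Linearising the hypothesis makes every \<open>x * y + y * x\<close> central;
    commuting it with \<open>x\<close> then makes every square central.\<close>
  have "x * y + y * x = ((x + y) * (x + y) - (x + y)) - (x * x - x) - (y * y - y)"
    by (simp add: algebra_simps)
  then have "(x * y + y * x) * x = x * (x * y + y * x)"
    using comm[of "x + y" x] comm[of x x] comm[of y x]
    by (simp only: left_diff_distrib right_diff_distrib)
  \<comment> \<open>Both sides expand with a term \<open>x * y * x\<close>, which cancels, so no
    assumption on 2-torsion enters.\<close>
  then have "x * x * y = y * (x * x)"
    by (simp add: algebra_simps)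
  \<comment> \<open>\<open>x\<close> is the difference of \<open>x * x\<close> and
    \<open>x * x - x\<close>, which both commute with \<open>y\<close>.\<close>
  then show "x * y = y * x"
    using comm[of x y] by (simp add: left_diff_distrib right_diff_distrib)
qed

end
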